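(* Let $X,Y$ be topological spaces, let $f$ be a bounded measurable function on $X\times Y$ separating measures on $X$, and let $T$ be an integral operator in $B(X)$ with a bounded signed kernel $p(x,dz)$ from $X$ to $X$. Then the $f$-dual operator $T^{D(f)}$ is well defined on $F(\mathcal{M}(X))$ and its action on the $f$-generated functions coincides with $T'$, that is, $$T^{D(f)}=F\circ T'\circ F^{-1},$$ or equivalently $$F^{-1}\circ T^{D(f)}=T'\circ F^{-1}.$$ In other words, the $f$-dual operator $T^{D(f)}$ is obtained by the "dressing" of the standard dual $T'$ by the operator $F$.
   Context: For a topological space $X$, $B(X)$ is the Banach space of bounded Borel measurable functions with the sup-norm, and $\mathcal{M}(X)$ is the Banach space of bounded signed ($\sigma$-additive) Borel measures on $X$ with the total variation norm. A signed kernel from $X$ to $X$ is a function $p(x,A)$ of $x\in X$ and Borel $A\subset X$ such that $p(x,\cdot)$ is a bounded signed measure for each $x$ and $p(\cdot,A)$ is a Borel function for each $A$; it is bounded if $\sup_x\|p(x,\cdot)\|<\infty$. The integral operator with kernel $p$ is $Tg(x)=\int_X g(z)\,p(x,dz)$; its standard dual $T':\mathcal{M}(X)\to\mathcal{M}(X)$ is $T'\mu(dz)=\int_X p(x,dz)\,\mu(dx)$. The function $f$ separates measures on $X$ if for any distinct $Q_1,Q_2\in\mathcal{M}(X)$ there exists $y\in Y$ with $\int f(x,y)Q_1(dx)\ne\int f(x,y)Q_2(dx)$. The operator $F:\mathcal{M}(X)\to B(Y)$ is $(FQ)(y)=\int_X f(x,y)\,Q(dx)$; when $f$ separates measures on $X$,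 $F$ is an injective bounded operator, so the linear inverse $F^{-1}$ is defined on the image $F(\mathcal{M}(X))$. The function $FQ$ is said to be $f$-generated by $Q$. An operator $T^{D(f)}:B(Y)\to B(Y)$ is called $f$-dual to $T$ if $$(T^{D(f)}f(x,\cdot))(y)=(Tf(\cdot,y))(x)\quad\text{for any }x\in X,\ y\in Y,$$ that is, applying $T^{D(f)}$ to the second argument of $f$ is equivalent to applying $T$ to its first argument.
   Formalization: Uniqueness of the f-dual operator on F(M(X)) is asserted among f-dual operators that commute with integration, (T^D FQ)(y)=∫(T^D f(x,·))(y)Q(dx); the pointwise duality relation alone does not determine it. Measurability of f is for the product σ-algebra. *)

theory Defs
  imports "HOL-Analysis.Analysis"
begin

definition bounded_borel :: "('a::topological_space \<Rightarrow> real) set" where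
  "bounded_borel = {g. g \<in> borel_measurable borel \<and> bounded (range g)}"

text \<open>
  A signed measure is a real-valued set function on the Borel sets. Outside the Borel sets it is
  fixed to be 0, so that equality of set functions is equality of measures.
\<close>

definition variation_sums :: "('a::topological_space set \<Rightarrow> real) \<Rightarrow> real set" where
  "variation_sums \<mu> = {\<Sum>A\<in>P. \<bar>\<mu> A\<bar> | P. finite P \<and> P \<subseteq> sets borel \<and> partition_on UNIV P}"

definition tv_norm :: "('a::topological_space set \<Rightarrow> real) \<Rightarrow> real" where
  "tv_norm \<mu> = Sup (variation_sums \<mu>)"

definition signed_measures :: "('a::topological_space set \<Rightarrow> real) set" where
  "signed_measures = {\<mu>.
     (\<forall>A. A \<notin> sets borel \<longrightarrow> \<mu> A = 0) \<and>
     (\<forall>A::nat \<Rightarrow> 'a set. range A \<subseteq> sets borel \<longrightarrow> disjoint_family A \<longrightarrow>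
        (\<lambda>i. \<mu> (A i)) sums \<mu> (\<Union>i. A i)) \<and>
     bdd_above (variation_sums \<mu>)}"

text \<open>
  The integral against a signed measure is taken through its Jordan decomposition. The positive
  part of \<open>\<mu>\<close> is \<open>A \<mapsto> sup {\<mu> B | B \<subseteq> A Borel}\<close>; \<^const>\<open>ennreal\<close> truncates negative values to 0,
  which does not change the supremum because \<open>B = {}\<close> contributes 0. The negative part is the
  positive part of \<open>- \<mu>\<close>.
\<close>

definition positive_part :: "('a::topological_space set \<Rightarrow> real) \<Rightarrow> 'a measure" where
  "positive_part \<mu> = measure_of UNIV (sets borel)
     (\<lambda>A. SUP B\<in>{B \<in> sets borel. B \<subseteq> A}. ennreal (\<mu> B))"

definition signed_integral :: "('a::topological_space set \<Rightarrow> real) \<Rightarrow> ('a \<Rightarrow> real) \<Rightarrow> real" where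
  "signed_integral \<mu> g =
     integral\<^sup>L (positive_part \<mu>) g - integral\<^sup>L (positive_part (\<lambda>A. - \<mu> A)) g"

definition bounded_signed_kernel :: "('a::topological_space \<Rightarrow> 'a set \<Rightarrow> real) \<Rightarrow> bool" where
  "bounded_signed_kernel p \<longleftrightarrow>
     (\<forall>x. p x \<in> signed_measures) \<and>
     (\<forall>A\<in>sets borel. (\<lambda>x. p x A) \<in> borel_measurable borel) \<and>
     bdd_above (range (\<lambda>x. tv_norm (p x)))"

definition kernel_op ::
  "('a::topological_space \<Rightarrow> 'a set \<Rightarrow> real) \<Rightarrow> ('a \<Rightarrow> real) \<Rightarrow> 'a \<Rightarrow> real" where
  "kernel_op p g = (\<lambda>x. signed_integral (p x) g)"

definition kernel_dual ::
  "('a::topological_space \<Rightarrow> 'a set \<Rightarrow> real) \<Rightarrow> ('a set \<Rightarrow> real) \<Rightarrow> 'a set \<Rightarrow> real" where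
  "kernel_dual p \<mu> = (\<lambda>A. if A \<in> sets borel then signed_integral \<mu> (\<lambda>x. p x A) else 0)"

definition separates_measures :: "('a::topological_space \<Rightarrow> 'b \<Rightarrow> real) \<Rightarrow> bool" where
  "separates_measures f \<longleftrightarrow>
     (\<forall>Q1\<in>signed_measures. \<forall>Q2\<in>signed_measures. Q1 \<noteq> Q2 \<longrightarrow>
        (\<exists>y. signed_integral Q1 (\<lambda>x. f x y) \<noteq> signed_integral Q2 (\<lambda>x. f x y)))"

definition F_op ::
  "('a::topological_space \<Rightarrow> 'b \<Rightarrow> real) \<Rightarrow> ('a set \<Rightarrow> real) \<Rightarrow> 'b \<Rightarrow> real" where
  "F_op f Q = (\<lambda>y. signed_integral Q (\<lambda>x. f x y))"

definition generated :: "('a::topological_space \<Rightarrow> 'b \<Rightarrow> real) \<Rightarrow> ('b \<Rightarrow> real) set" where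
  "generated f = F_op f ` signed_measures"

definition F_inv ::
  "('a::topological_space \<Rightarrow> 'b \<Rightarrow> real) \<Rightarrow> ('b \<Rightarrow> real) \<Rightarrow> 'a set \<Rightarrow> real" where
  "F_inv f = the_inv_into signed_measures (F_op f)"

lemma inj_on_F_op: "separates_measures f \<Longrightarrow> inj_on (F_op f) signed_measures"
  unfolding separates_measures_def F_op_def inj_on_def by metis

definition linear_operator_on ::
  "('b::topological_space \<Rightarrow> real) set \<Rightarrow> (('b \<Rightarrow> real) \<Rightarrow> 'b \<Rightarrow> real) \<Rightarrow> bool" where
  "linear_operator_on V S \<longleftrightarrow>
     V \<subseteq> bounded_borel \<and> S ` V \<subseteq> bounded_borel \<and>
     (\<forall>g\<in>V. \<forall>h\<in>V. \<forall>a b.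
        (\<lambda>y. a * g y + b * h y) \<in> V \<and>
        S (\<lambda>y. a * g y + b * h y) = (\<lambda>y. a * S g y + b * S h y))"

text \<open>
  \<open>S\<close> is \<open>f\<close>-dual to \<open>T\<close>, as an operator defined on the subspace \<open>V\<close> of the bounded Borel functions
  (the whole space is the case \<open>V = bounded_borel\<close>).
\<close>

definition f_dual_on ::
  "('b::topological_space \<Rightarrow> real) set \<Rightarrow> ('a::topological_space \<Rightarrow> 'b \<Rightarrow> real) \<Rightarrow>
   (('a \<Rightarrow> real) \<Rightarrow> 'a \<Rightarrow> real) \<Rightarrow> (('b \<Rightarrow> real) \<Rightarrow> 'b \<Rightarrow> real) \<Rightarrow> bool" where
  "f_dual_on V f T S \<longleftrightarrow>
     linear_operator_on V S \<and>
     (\<forall>x. f x \<in> V) \<and>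
     (\<forall>x y. S (f x) y = T (\<lambda>x'. f x' y) x)"

text \<open>
  The duality relation prescribes an operator only on the functions \<open>f x\<close>, which are generated by
  the point masses; by linearity alone this does not determine it on all generated functions.
  An \<open>f\<close>-dual operator acts on \<open>F_op f Q = \<integral> f x Q(dx)\<close> by being applied to the second argument
  of \<open>f\<close> under the integral.
\<close>

definition acts_under_integral ::
  "('a::topological_space \<Rightarrow> 'b \<Rightarrow> real) \<Rightarrow> (('b \<Rightarrow> real) \<Rightarrow> 'b \<Rightarrow> real) \<Rightarrow> bool" where
  "acts_under_integral f S \<longleftrightarrow>
     (\<forall>Q\<in>signed_measures. \<forall>y. S (F_op f Q) y = signed_integral Q (\<lambda>x. S (f x) y))"

end

theory Submission
  imports Defs
begin

text \<open>
  For bounded Borel functions the integral against a signed measure is determined by linearity,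
  bounded convergence and its values on indicators. Fubini for kernels therefore follows by
  approximating \<open>g\<close>: \<open>\<integral> g d(T'\<mu>) = \<integral> T g d\<mu>\<close>. Taking \<open>g = f(\<cdot>, y)\<close> gives
  \<open>F (T' Q) y = \<integral> T (f(\<cdot>, y)) dQ\<close>, and by duality the right-hand side is the integral against \<open>Q\<close> of
  an \<open>f\<close>-dual operator applied to \<open>f x\<close>, that is, its value at \<open>F Q\<close>. For existence, \<open>f x = F \<delta>\<^sub>x\<close> and
  \<open>T' \<delta>\<^sub>x = p x\<close> show that \<open>F \<circ> T' \<circ> F\<^sup>-\<^sup>1\<close> is \<open>f\<close>-dual to \<open>T\<close>.
\<close>

section \<open>Bounded Borel functions and induction by bounded pointwise limits\<close>

lemma bounded_borelI:
  assumes "g \<in> borel_measurable borel" and "\<And>x. \<bar>g x\<bar> \<le> K"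
  shows "g \<in> bounded_borel"
  using assms unfolding bounded_borel_def bounded_iff by auto

lemma bounded_borelE:
  assumes "g \<in> bounded_borel"
  obtains K where "g \<in> borel_measurable borel" "0 \<le> K" "\<And>x. \<bar>g x\<bar> \<le> K"
proof -
  from assms obtain K where "g \<in> borel_measurable borel" "\<And>x. \<bar>g x\<bar> \<le> K"
    unfolding bounded_borel_def bounded_iff by auto
  then show thesis using that[of K] by (metis abs_ge_zero order_trans)
qed

lemma bounded_borel_measurable: "g \<in> bounded_borel \<Longrightarrow> g \<in> borel_measurable borel"
  by (simp add: bounded_borel_def)

lemma bounded_borel_indicator: "A \<in> sets borel \<Longrightarrow> indicat_real A \<in> bounded_borel"
  by (rule bounded_borelI[where K=1]) (auto simp: indicator_def)

lemma bounded_borel_scale: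
  assumes "g \<in> bounded_borel"
  shows "(\<lambda>x. c * g x) \<in> bounded_borel"
proof -
  obtain K where "g \<in> borel_measurable borel" "0 \<le> K" "\<And>x. \<bar>g x\<bar> \<le> K"
    using assms by (rule bounded_borelE) blast
  then show ?thesis
    by (intro bounded_borelI[where K="\<bar>c\<bar> * K"]) (auto simp: abs_mult intro: mult_left_mono)
qed

text \<open>Reduces an identity between integrals to indicators. The limit case carries a bound
  uniform in \<open>n\<close>, so that bounded convergence applies there. A nonnegative function is
  built up by the standard measurable induction; one of arbitrary sign is shifted to be nonnegative
  first.\<close>

lemma bounded_borel_induct [consumes 1, case_names indicator scale add lim]:
  assumes g: "g \<in> bounded_borel"
    and ind: "\<And>A. A \<in> sets borel \<Longrightarrow> P (indicat_real A)"
    and scale: "\<And>c g. g \<in> bounded_borel \<Longrightarrow> P g \<Longrightarrow> P (\<lambda>x. c * g x)"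
    and add: "\<And>g h. g \<in> bounded_borel \<Longrightarrow> P g \<Longrightarrow> h \<in> bounded_borel \<Longrightarrow> P h \<Longrightarrow>
      P (\<lambda>x. g x + h x)"
    and lim: "\<And>U K g. (\<And>n. U n \<in> borel_measurable borel) \<Longrightarrow> (\<And>n x. \<bar>U n x\<bar> \<le> K) \<Longrightarrow>
      (\<And>n. P (U n)) \<Longrightarrow> (\<And>x. (\<lambda>n. U n x) \<longlonglongrightarrow> g x) \<Longrightarrow> P g"
  shows "P g"
proof -
  \<comment> \<open>The bound \<open>K\<close> is quantified inside the induction predicate, because
    the summands and approximants must inherit a bound from the function they make up.\<close>
  have nonneg: "(\<forall>K. (\<forall>x. h x \<le> K) \<longrightarrow> P h)"
    if "h \<in> borel_measurable borel" "\<And>x. 0 \<le> h x" for h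
    using that
  proof (induction h rule: borel_measurable_induct_real)
    case (set A)
    then show ?case using ind by simp
  next
    case (mult u c)
    show ?case
    proof (intro allI impI)
      fix K assume K: "\<forall>x. c * u x \<le> K"
      show "P (\<lambda>x. c * u x)"
      proof (cases "c = 0")
        case True
        \<comment> \<open>For \<open>c = 0\<close> the bound on \<open>c * u\<close> says nothing
          about \<open>u\<close>, so the induction hypothesis cannot be used; the zero function is
          obtained as a multiple of an indicator instead.\<close>
        have "P (\<lambda>x. 0 * indicat_real {} x)"
          by (intro scale ind bounded_borel_indicator) auto
        then show ?thesis using True by simp
      next
        case False
        then have "\<forall>x. u x \<le> K / c"
          using K mult by (simp add: field_simps)
        then have "P u" "u \<in> bounded_borel"
          using mult by (auto intro!: bounded_borelI[where K="K / c"])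
        then show ?thesis by (intro scale)
      qed
    qed
  next
    case (add u v)
    show ?case
    proof (intro allI impI)
      fix K assume K: "\<forall>x. v x + u x \<le> K"
      \<comment> \<open>Nonnegativity of both summands lets each inherit the bound of the
        sum.\<close>
      have "0 \<le> u x" "0 \<le> v x" for x
        by (rule add)+
      then have "u x \<le> K" "v x \<le> K" for x
        using K by (smt (verit))+
      then have "P u" "P v"
        using add.IH by blast+
      moreover have "u \<in> bounded_borel" "v \<in> bounded_borel"
        using add.hyps \<open>\<And>x. u x \<le> K\<close> \<open>\<And>x. v x \<le> K\<close> by (auto intro!: bounded_borelI[where K=K])
      ultimately show "P (\<lambda>x. v x + u x)" by (intro assms(4))
    qed
  next
    case (seq U)
    show ?case
    proof (intro allI impI)
      fix K assume K: "\<forall>x. h x \<le> K"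
      \<comment> \<open>The approximants increase to \<open>h\<close>, hence lie below it and share
        its bound.\<close>
      have "U n x \<le> h x" for n x
        using incseq_le[of "\<lambda>n. U n x" "h x" n] seq by (auto simp: incseq_def le_fun_def)
      then have le: "U n x \<le> K" for n x
        using K order_trans by blast
      then have "P (U n)" for n
        using seq by blast
      then show "P h"
        using seq le by (intro lim[of U K h]) auto
    qed
  qed
  obtain K where K: "g \<in> borel_measurable borel" "\<And>x. \<bar>g x\<bar> \<le> K"
    using g by (rule bounded_borelE) blast
  \<comment> \<open>Adding the bound \<open>K\<close> makes \<open>g\<close> nonnegative and bounded
    by \<open>2 * K\<close>; the shift is undone below by adding \<open>- K\<close> times the
    indicator of the whole space.\<close>
  have gK: "0 \<le> g x + K" "g x + K \<le> 2 * K" for x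
    using K(2)[of x] by linarith+
  have "(\<lambda>x. g x + K) \<in> borel_measurable borel"
    using K(1) by simp
  then have "P (\<lambda>x. g x + K)" "(\<lambda>x. g x + K) \<in> bounded_borel"
    using nonneg[of "\<lambda>x. g x + K"] gK
    by (blast, intro bounded_borelI[where K="2 * K"], auto)
  moreover have "P (\<lambda>x. - K * indicat_real UNIV x)"
    by (intro scale ind bounded_borel_indicator) auto
  ultimately have "P (\<lambda>x. (g x + K) + (- K * indicat_real UNIV x))"
    using add[of "\<lambda>x. g x + K" "\<lambda>x. - K * indicat_real UNIV x"]
      bounded_borel_scale[OF bounded_borel_indicator[of UNIV], of "- K"] by simp
  then show ?thesis by simp
qed

section \<open>Signed measures: additivity and bounds by the total variation\<close>

lemma signed_measure_outside: "\<mu> \<in> signed_measures \<Longrightarrow> A \<notin> sets borel \<Longrightarrow> \<mu> A = 0"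
  by (simp add: signed_measures_def)

lemma signed_measure_sums:
  "\<mu> \<in> signed_measures \<Longrightarrow> range A \<subseteq> sets borel \<Longrightarrow> disjoint_family A \<Longrightarrow>
    (\<lambda>i. \<mu> (A i)) sums \<mu> (\<Union>i. A i)"
  by (simp add: signed_measures_def)

text \<open>Assumes countable additivity alone rather than membership in
  \<open>signed_measures\<close>, since it also serves to establish that membership.\<close>

lemma additive_of_sums:
  fixes \<mu> :: "'a::topological_space set \<Rightarrow> real"
  assumes sums: "\<And>A::nat \<Rightarrow> 'a set. range A \<subseteq> sets borel \<Longrightarrow> disjoint_family A \<Longrightarrow>
      (\<lambda>i. \<mu> (A i)) sums \<mu> (\<Union>i. A i)"
  shows "\<mu> {} = 0"
    and "\<And>A B. A \<in> sets borel \<Longrightarrow> B \<in> sets borel \<Longrightarrow> A \<inter> B = {} \<Longrightarrow> \<mu> (A \<union> B) = \<mu> A + \<mu> B"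
proof -
  \<comment> \<open>A convergent series with constant terms has all terms 0.\<close>
  have "(\<lambda>i::nat. \<mu> {}) sums \<mu> (\<Union>i::nat. {})"
    by (rule sums) (auto simp: disjoint_family_on_def)
  then have "(\<lambda>i::nat. \<mu> {}) \<longlonglongrightarrow> 0"
    using sums_summable summable_LIMSEQ_zero by blast
  then show empty: "\<mu> {} = 0"
    by (simp add: LIMSEQ_const_iff)
  fix A B :: "'a set" assume AB: "A \<in> sets borel" "B \<in> sets borel" "A \<inter> B = {}"
  have "(\<lambda>i. \<mu> (binaryset A B i)) sums \<mu> (\<Union>i. binaryset A B i)"
    using AB by (intro sums) (auto simp: binaryset_def disjoint_family_on_def)
  moreover have "(\<lambda>i. \<mu> (binaryset A B i)) sums (\<mu> A + \<mu> B)"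
    using empty by (intro binaryset_sums) auto
  ultimately show "\<mu> (A \<union> B) = \<mu> A + \<mu> B"
    using sums_unique2 UN_binaryset_eq by metis
qed

lemma signed_measure_empty: "\<mu> \<in> signed_measures \<Longrightarrow> \<mu> {} = 0"
  by (rule additive_of_sums(1)) (rule signed_measure_sums)

lemma signed_measure_Un:
  "\<mu> \<in> signed_measures \<Longrightarrow> A \<in> sets borel \<Longrightarrow> B \<in> sets borel \<Longrightarrow> A \<inter> B = {} \<Longrightarrow>
    \<mu> (A \<union> B) = \<mu> A + \<mu> B"
  by (rule additive_of_sums(2)) (auto intro: signed_measure_sums)

text \<open>Group the blocks by the sign of \<open>\<mu>\<close>. By additivity each group
  contributes the absolute value of \<open>\<mu>\<close> on a single Borel set, which is at most
  \<open>C\<close>; the two groups give the factor 2.\<close>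

lemma variation_sum_le:
  fixes \<mu> :: "'a::topological_space set \<Rightarrow> real"
  assumes empty: "\<mu> {} = 0"
    and Un: "\<And>A B. A \<in> sets borel \<Longrightarrow> B \<in> sets borel \<Longrightarrow> A \<inter> B = {} \<Longrightarrow> \<mu> (A \<union> B) = \<mu> A + \<mu> B"
    and C: "\<And>A. A \<in> sets borel \<Longrightarrow> \<bar>\<mu> A\<bar> \<le> C"
    and P: "finite P" "P \<subseteq> sets borel" "disjoint P"
  shows "(\<Sum>A\<in>P. \<bar>\<mu> A\<bar>) \<le> 2 * C"
proof -
  have union: "(\<Sum>A\<in>R. \<mu> A) = \<mu> (\<Union>R)" if "R \<subseteq> P" for R
  proof -
    from that have "finite R" using P(1) finite_subset by blast
    then show ?thesis using that
    proof (induction R)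
      case empty
      then show ?case using assms(1) by simp
    next
      case (insert A R)
      have "A \<inter> \<Union>R = {}"
        using insert P(3) by (fastforce simp: disjoint_def)
      moreover have "A \<in> sets borel" "\<Union>R \<in> sets borel"
        using insert P(2) by (auto intro!: sets.finite_Union)
      ultimately show ?case using insert Un by simp
    qed
  qed
  let ?R = "{A\<in>P. 0 \<le> \<mu> A}"
  have "(\<Sum>A\<in>P. \<bar>\<mu> A\<bar>) = (\<Sum>A\<in>?R. \<bar>\<mu> A\<bar>) + (\<Sum>A\<in>P - ?R. \<bar>\<mu> A\<bar>)"
    using P(1) by (subst add.commute, intro sum.subset_diff) auto
  also have "\<dots> = (\<Sum>A\<in>?R. \<mu> A) - (\<Sum>A\<in>P - ?R. \<mu> A)"
    by (simp add: sum_negf[symmetric] del: sum_negf) (intro sum.cong, auto)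
  also have "\<dots> = \<mu> (\<Union>?R) - \<mu> (\<Union>(P - ?R))"
    by (simp add: union)
  also have "\<dots> \<le> 2 * C"
  proof -
    have "\<Union>?R \<in> sets borel" "\<Union>(P - ?R) \<in> sets borel"
      using P by (auto intro!: sets.finite_Union)
    then show ?thesis using C[of "\<Union>?R"] C[of "\<Union>(P - ?R)"] by linarith
  qed
  finally show ?thesis .
qed

text \<open>A countably additive real set function has bounded variation as soon as its values are
  bounded, so the variation condition never has to be checked on partitions.\<close>

lemma signed_measuresI:
  fixes \<mu> :: "'a::topological_space set \<Rightarrow> real"
  assumes "\<And>A. A \<notin> sets borel \<Longrightarrow> \<mu> A = 0"
    and sums: "\<And>A::nat \<Rightarrow> 'a set. range A \<subseteq> sets borel \<Longrightarrow> disjoint_family A \<Longrightarrow>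
      (\<lambda>i. \<mu> (A i)) sums \<mu> (\<Union>i. A i)"
    and C: "\<And>A. A \<in> sets borel \<Longrightarrow> \<bar>\<mu> A\<bar> \<le> C"
  shows "\<mu> \<in> signed_measures"
proof -
  have "bdd_above (variation_sums \<mu>)"
  proof (rule bdd_aboveI)
    fix s assume "s \<in> variation_sums \<mu>"
    then obtain P where "finite P" "P \<subseteq> sets borel" "disjoint P" "s = (\<Sum>A\<in>P. \<bar>\<mu> A\<bar>)"
      unfolding variation_sums_def partition_on_def by auto
    then show "s \<le> 2 * C"
      using variation_sum_le[of \<mu> C P] additive_of_sums[of \<mu>, OF sums] C by auto
  qed
  then show ?thesis using assms by (auto simp: signed_measures_def)
qed

text \<open>A Borel set and its complement form a partition, whose variation sum already dominates
  the value on the set.\<close>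

lemma abs_signed_measure_le:
  assumes "\<mu> \<in> signed_measures"
  shows "\<bar>\<mu> A\<bar> \<le> tv_norm \<mu>"
proof -
  have bdd: "bdd_above (variation_sums \<mu>)"
    using assms by (simp add: signed_measures_def)
  have le: "\<bar>\<mu> A\<bar> \<le> tv_norm \<mu>" if A: "A \<in> sets borel" for A
  proof -
    \<comment> \<open>\<open>partition_on\<close> forbids empty blocks, and one would occur for
      \<open>A = {}\<close> or \<open>A = UNIV\<close>.\<close>
    let ?P = "{A, - A} - {{}}"
    have "(\<Sum>B\<in>?P. \<bar>\<mu> B\<bar>) \<in> variation_sums \<mu>"
      unfolding variation_sums_def using A
      by (intro CollectI exI[of _ ?P]) (auto simp: partition_on_def disjoint_def)
    then have "(\<Sum>B\<in>?P. \<bar>\<mu> B\<bar>) \<le> tv_norm \<mu>"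
      unfolding tv_norm_def by (intro cSup_upper bdd)
    moreover have "\<bar>\<mu> A\<bar> \<le> (\<Sum>B\<in>?P. \<bar>\<mu> B\<bar>)"
    proof (cases "A = {}")
      case True
      then show ?thesis using signed_measure_empty[OF assms] by (auto intro: sum_nonneg)
    next
      case False
      then show ?thesis by (intro member_le_sum) auto
    qed
    ultimately show ?thesis by linarith
  qed
  \<comment> \<open>Off the Borel sets the value is 0, and \<open>le\<close> at \<open>{}\<close>
    shows that \<open>tv_norm \<mu>\<close> is nonnegative.\<close>
  show ?thesis
    using le[of A] le[of "{}"] signed_measure_outside[OF assms, of A]
    by (cases "A \<in> sets borel") auto
qed

lemma signed_measure_lincomb:
  assumes \<mu>: "\<mu> \<in> signed_measures" and \<nu>: "\<nu> \<in> signed_measures"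
  shows "(\<lambda>A. a * \<mu> A + b * \<nu> A) \<in> signed_measures"
proof (rule signed_measuresI)
  show "\<bar>a * \<mu> A + b * \<nu> A\<bar> \<le> \<bar>a\<bar> * tv_norm \<mu> + \<bar>b\<bar> * tv_norm \<nu>" for A
  proof -
    have "\<bar>a * \<mu> A + b * \<nu> A\<bar> \<le> \<bar>a\<bar> * \<bar>\<mu> A\<bar> + \<bar>b\<bar> * \<bar>\<nu> A\<bar>"
      by (metis abs_mult abs_triangle_ineq)
    also have "\<dots> \<le> \<bar>a\<bar> * tv_norm \<mu> + \<bar>b\<bar> * tv_norm \<nu>"
      by (intro add_mono mult_left_mono abs_signed_measure_le assms) auto
    finally show ?thesis .
  qed
qed (auto intro!: sums_add sums_mult signed_measure_sums assms
       simp: signed_measure_outside[OF \<mu>] signed_measure_outside[OF \<nu>])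

lemma signed_measure_uminus:
  "\<mu> \<in> signed_measures \<Longrightarrow> (\<lambda>A. - \<mu> A) \<in> signed_measures"
  using signed_measure_lincomb[of \<mu> \<mu> "- 1" 0] by simp

section \<open>The positive part as a finite measure, and the Jordan decomposition\<close>

lemma sets_positive_part [simp, measurable_cong]:
  fixes \<mu> :: "'a::topological_space set \<Rightarrow> real"
  shows "sets (positive_part \<mu>) = sets borel"
  unfolding positive_part_def
  using sets.sets_measure_of_eq[of "borel :: 'a measure"] by simp

lemma space_positive_part [simp]: "space (positive_part \<mu>) = UNIV"
  using sets_eq_imp_space_eq[OF sets_positive_part] by simp

lemma disjoint_family_UN_lessThan:
  fixes A :: "nat \<Rightarrow> 'a set"
  assumes "disjoint_family A"
  shows "(\<Union>i<n. A i) \<inter> A n = {}"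
proof -
  have "A i \<inter> A n = {}" if "i < n" for i
    using assms that by (simp add: disjoint_family_on_def)
  then show ?thesis by blast
qed

text \<open>If \<open>C\<close> competes in the supremum for \<open>A\<close> and \<open>D\<close>
  in that for \<open>B\<close>, then the disjoint union \<open>C \<union> D\<close> competes for
  \<open>A \<union> B\<close>. A competitor of negative value counts as 0 under
  \<open>ennreal\<close>; it is dropped and the other used alone, whence the case split.\<close>

lemma SUP_subsets_superadditive:
  assumes \<mu>: "\<mu> \<in> signed_measures" and disj: "A \<inter> B = {}"
  defines "m \<equiv> \<lambda>A. SUP B\<in>{B \<in> sets borel. B \<subseteq> A}. ennreal (\<mu> B)"
  shows "m A + m B \<le> m (A \<union> B)"
proof -
  have le: "ennreal (\<mu> C) + ennreal (\<mu> D) \<le> m (A \<union> B)"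
    if C: "C \<in> sets borel" "C \<subseteq> A" and D: "D \<in> sets borel" "D \<subseteq> B" for C D
  proof -
    have up: "ennreal (\<mu> E) \<le> m (A \<union> B)" if "E \<in> sets borel" "E \<subseteq> A \<union> B" for E
      unfolding m_def using that by (intro SUP_upper) auto
    consider "\<mu> C \<le> 0" | "\<mu> D \<le> 0" | "0 \<le> \<mu> C" "0 \<le> \<mu> D" by linarith
    then show ?thesis
    proof cases
      case 3
      then have "ennreal (\<mu> C) + ennreal (\<mu> D) = ennreal (\<mu> (C \<union> D))"
        using C D disj by (subst signed_measure_Un[OF \<mu>]) (auto simp: ennreal_plus)
      then show ?thesis using up[of "C \<union> D"] C D by auto
    next
      case 1
      then show ?thesis using up[of D] D by (auto simp: ennreal_neg)
    next
      case 2
      then show ?thesis using up[of C] C by (auto simp: ennreal_neg)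
    qed
  qed
  let ?I = "\<lambda>A. {B \<in> sets borel. B \<subseteq> A}"
  have ne: "?I A \<noteq> {}" for A :: "'a set" by auto
  have "m A + m B = (SUP C\<in>?I A. ennreal (\<mu> C) + m B)"
    unfolding m_def by (rule ennreal_SUP_add_left[OF ne, symmetric])
  also have "\<dots> \<le> m (A \<union> B)"
  proof (rule SUP_least)
    fix C assume C: "C \<in> ?I A"
    have "ennreal (\<mu> C) + m B = (SUP D\<in>?I B. ennreal (\<mu> C) + ennreal (\<mu> D))"
      unfolding m_def by (rule ennreal_SUP_add_right[OF ne])
    also have "\<dots> \<le> m (A \<union> B)"
      using C le by (intro SUP_least) auto
    finally show "ennreal (\<mu> C) + m B \<le> m (A \<union> B)" .
  qed
  finally show ?thesis .
qed

text \<open>Truncation at 0 is subadditive. Terms of either sign must be allowed, since the pieces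
  of a competitor set may have negative mass.\<close>

lemma ennreal_sum_le: "ennreal (\<Sum>i\<in>I. a i) \<le> (\<Sum>i\<in>I. ennreal (a i))"
proof -
  have "ennreal (\<Sum>i\<in>I. a i) \<le> ennreal (\<Sum>i\<in>I. max 0 (a i))"
    by (intro ennreal_leI sum_mono) auto
  also have "\<dots> = (\<Sum>i\<in>I. ennreal (max 0 (a i)))"
    by (rule sum_ennreal[symmetric]) auto
  also have "\<dots> = (\<Sum>i\<in>I. ennreal (a i))"
    by (intro sum.cong) (auto simp: max_def ennreal_neg)
  finally show ?thesis .
qed

text \<open>\<open>measure_of\<close> returns the prescribed set function only once it is known to
  be a measure. Countable additivity of the supremum is the point: superadditivity gives one
  inequality, cutting a competitor along the \<open>A i\<close> the other.\<close>

lemma emeasure_positive_part: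
  assumes \<mu>: "\<mu> \<in> signed_measures" and A: "A \<in> sets borel"
  shows "emeasure (positive_part \<mu>) A = (SUP B\<in>{B \<in> sets borel. B \<subseteq> A}. ennreal (\<mu> B))"
proof -
  define m where "m A = (SUP B\<in>{B \<in> sets borel. B \<subseteq> A}. ennreal (\<mu> B))" for A
  have m_mono: "m A \<le> m B" if "A \<subseteq> B" for A B
    unfolding m_def using that by (intro SUP_subset_mono) auto
  have m_upper: "ennreal (\<mu> B) \<le> m A" if "B \<in> sets borel" "B \<subseteq> A" for A B
    unfolding m_def using that by (intro SUP_upper) auto
  have "{B \<in> sets borel. B \<subseteq> {}} = {{} :: 'a set}" by auto
  then have m_empty: "m {} = 0"
    unfolding m_def by (simp add: signed_measure_empty[OF \<mu>])
  have "countably_additive (sets borel) m"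
  proof (rule countably_additiveI)
    fix A :: "nat \<Rightarrow> 'a set"
    assume A: "range A \<subseteq> sets borel" "disjoint_family A"
    show "(\<Sum>i. m (A i)) = m (\<Union>i. A i)"
    proof (rule antisym)
      \<comment> \<open>Superadditivity iterated over finitely many sets; the infinite sum is the
        supremum of these partial sums.\<close>
      have "(\<Sum>i<n. m (A i)) \<le> m (\<Union>i<n. A i)" for n
      proof (induction n)
        case 0
        then show ?case by (simp add: m_empty)
      next
        case (Suc n)
        have "(\<Union>i<n. A i) \<inter> A n = {}"
          using A(2) by (rule disjoint_family_UN_lessThan)
        then have "m (\<Union>i<n. A i) + m (A n) \<le> m ((\<Union>i<n. A i) \<union> A n)"
          unfolding m_def by (rule SUP_subsets_superadditive[OF \<mu>])
        then have "(\<Sum>i<n. m (A i)) + m (A n) \<le> m ((\<Union>i<n. A i) \<union> A n)"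
          using add_right_mono[OF Suc] by (rule order_trans[rotated])
        then show ?case
          by (simp add: lessThan_Suc Un_commute add.commute)
      qed
      then have "(\<Sum>i<n. m (A i)) \<le> m (\<Union>i. A i)" for n
        by (rule order_trans) (auto intro: m_mono)
      then show "(\<Sum>i. m (A i)) \<le> m (\<Union>i. A i)"
        by (simp add: suminf_eq_SUP SUP_least)
    next
      \<comment> \<open>Each piece \<open>B \<inter> A i\<close> competes in the supremum for
        \<open>A i\<close>, so every partial sum of the series for \<open>\<mu> B\<close> is bounded
        by the right-hand side.\<close>
      have "ennreal (\<mu> B) \<le> (\<Sum>i. m (A i))" if B: "B \<in> sets borel" "B \<subseteq> (\<Union>i. A i)" for B
      proof -
        have "(\<lambda>i. \<mu> (B \<inter> A i)) sums \<mu> (\<Union>i. B \<inter> A i)"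
          using A B by (intro signed_measure_sums[OF \<mu>]) (auto simp: disjoint_family_on_def)
        moreover have "(\<Union>i. B \<inter> A i) = B" using B by auto
        ultimately have "(\<lambda>n. ennreal (\<Sum>i<n. \<mu> (B \<inter> A i))) \<longlonglongrightarrow> ennreal (\<mu> B)"
          unfolding sums_def by (intro tendsto_ennrealI) simp
        moreover have "ennreal (\<Sum>i<n. \<mu> (B \<inter> A i)) \<le> (\<Sum>i. m (A i))" for n
        proof -
          have "ennreal (\<Sum>i<n. \<mu> (B \<inter> A i)) \<le> (\<Sum>i<n. ennreal (\<mu> (B \<inter> A i)))"
            by (rule ennreal_sum_le)
          also have "\<dots> \<le> (\<Sum>i<n. m (A i))"
            using A B by (intro sum_mono m_upper) auto
          also have "\<dots> \<le> (\<Sum>i. m (A i))"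
            by (intro sum_le_suminf) auto
          finally show ?thesis .
        qed
        ultimately show ?thesis
          by (intro LIMSEQ_le_const2) auto
      qed
      then show "m (\<Union>i. A i) \<le> (\<Sum>i. m (A i))"
        unfolding m_def[of "\<Union>i. A i"] by (intro SUP_least) auto
    qed
  qed
  moreover have "positive (sets borel) m"
    by (simp add: positive_def m_empty)
  moreover have "sigma_algebra UNIV (sets (borel :: 'a measure))"
    using sets.sigma_algebra_axioms[of "borel :: 'a measure"] by simp
  ultimately show ?thesis
    unfolding positive_part_def m_def[symmetric] using A by (intro emeasure_measure_of_sigma)
qed

lemma emeasure_positive_part_le:
  assumes "\<mu> \<in> signed_measures" and "A \<in> sets borel"
    and "\<And>B. B \<in> sets borel \<Longrightarrow> B \<subseteq> A \<Longrightarrow> \<mu> B \<le> c"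
  shows "emeasure (positive_part \<mu>) A \<le> ennreal c"
  using assms by (auto simp: emeasure_positive_part intro!: SUP_least ennreal_leI)

lemma finite_measure_positive_part:
  assumes "\<mu> \<in> signed_measures"
  shows "finite_measure (positive_part \<mu>)"
proof (rule finite_measureI)
  have "\<mu> B \<le> tv_norm \<mu>" for B
    using abs_signed_measure_le[OF assms, of B] by linarith
  then have "emeasure (positive_part \<mu>) UNIV \<le> ennreal (tv_norm \<mu>)"
    using assms by (intro emeasure_positive_part_le) auto
  then show "emeasure (positive_part \<mu>) (space (positive_part \<mu>)) \<noteq> \<infinity>"
    by (auto simp: top_unique)
qed

lemma measure_positive_part_le:
  assumes "\<mu> \<in> signed_measures" and "A \<in> sets borel"
    and "\<And>B. B \<in> sets borel \<Longrightarrow> B \<subseteq> A \<Longrightarrow> \<mu> B \<le> c"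
  shows "measure (positive_part \<mu>) A \<le> c"
proof -
  \<comment> \<open>The empty competitor forces \<open>c\<close> to be nonnegative, so passing from
    \<open>ennreal\<close> back to reals loses nothing.\<close>
  have "0 \<le> c"
    using assms(3)[of "{}"] signed_measure_empty[OF assms(1)] by auto
  then show ?thesis
    using emeasure_positive_part_le[OF assms] by (simp add: enn2real_leI measure_def)
qed

lemma measure_positive_part_ge:
  assumes "\<mu> \<in> signed_measures" and "A \<in> sets borel" and "B \<in> sets borel" and "B \<subseteq> A"
  shows "\<mu> B \<le> measure (positive_part \<mu>) A"
proof -
  interpret finite_measure "positive_part \<mu>"
    by (rule finite_measure_positive_part) fact
  have "ennreal (\<mu> B) \<le> emeasure (positive_part \<mu>) A"
    using assms by (auto simp: emeasure_positive_part intro!: SUP_upper)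
  then show ?thesis
    by (simp add: emeasure_eq_measure)
qed

lemma measure_positive_part_le_tv_norm:
  assumes "\<mu> \<in> signed_measures"
  shows "measure (positive_part \<mu>) UNIV \<le> tv_norm \<mu>"
proof (rule measure_positive_part_le)
  show "\<mu> B \<le> tv_norm \<mu>" for B
    using abs_signed_measure_le[OF assms, of B] by linarith
qed (use assms in auto)

lemma tv_norm_uminus: "tv_norm (\<lambda>A. - \<mu> A) = tv_norm \<mu>"
  by (simp add: tv_norm_def variation_sums_def)

text \<open>For \<open>B \<subseteq> A\<close> one has \<open>\<mu> B = \<mu> A - \<mu> (A - B)\<close>; taking suprema over \<open>B\<close> gives the Jordan
  decomposition without a Hahn decomposition.\<close>

lemma jordan_decomposition:
  assumes \<mu>: "\<mu> \<in> signed_measures" and A: "A \<in> sets borel"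
  shows "measure (positive_part \<mu>) A - measure (positive_part (\<lambda>A. - \<mu> A)) A = \<mu> A"
proof -
  have le: "measure (positive_part \<nu>) A \<le> \<nu> A + measure (positive_part (\<lambda>A. - \<nu> A)) A"
    if \<nu>: "\<nu> \<in> signed_measures" for \<nu>
  proof (rule measure_positive_part_le[OF \<nu> A])
    fix B :: "'a set" assume B: "B \<in> sets borel" "B \<subseteq> A"
    have "\<nu> A = \<nu> B + \<nu> (A - B)"
      using signed_measure_Un[OF \<nu>, of B "A - B"] A B by (auto simp: Un_absorb1)
    moreover have "- \<nu> (A - B) \<le> measure (positive_part (\<lambda>A. - \<nu> A)) A"
      using A B by (intro measure_positive_part_ge signed_measure_uminus \<nu>) auto
    ultimately show "\<nu> B \<le> \<nu> A + measure (positive_part (\<lambda>A. - \<nu> A)) A"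
      by linarith
  qed
  \<comment> \<open>The inequality at \<open>\<mu>\<close> gives one direction, and at its negative
    the other.\<close>
  show ?thesis
    using le[OF \<mu>] le[OF signed_measure_uminus[OF \<mu>], unfolded minus_minus] by linarith
qed

section \<open>Integration against signed measures\<close>

lemma integrable_positive_part:
  assumes "\<mu> \<in> signed_measures" and "g \<in> bounded_borel"
  shows "integrable (positive_part \<mu>) g"
proof -
  interpret finite_measure "positive_part \<mu>"
    by (rule finite_measure_positive_part) fact
  obtain K where "g \<in> borel_measurable borel" "\<And>x. \<bar>g x\<bar> \<le> K"
    using assms(2) by (rule bounded_borelE) blast
  then show ?thesis
    by (intro integrable_const_bound[where B=K]) auto
qed

lemma signed_integral_indicator:
  assumes "\<mu> \<in> signed_measures" and "A \<in> sets borel"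
  shows "signed_integral \<mu> (indicat_real A) = \<mu> A"
  using jordan_decomposition[OF assms] assms(2) by (simp add: signed_integral_def)

lemma signed_integral_scale:
  "signed_integral \<mu> (\<lambda>x. c * g x) = c * signed_integral \<mu> g"
  by (simp add: signed_integral_def right_diff_distrib)

lemma signed_integral_add:
  assumes "\<mu> \<in> signed_measures" and "g \<in> bounded_borel" and "h \<in> bounded_borel"
  shows "signed_integral \<mu> (\<lambda>x. g x + h x) = signed_integral \<mu> g + signed_integral \<mu> h"
  using assms by (simp add: signed_integral_def integrable_positive_part signed_measure_uminus)

lemma signed_integral_sum:
  assumes "\<mu> \<in> signed_measures" and "\<And>i. i \<in> I \<Longrightarrow> g i \<in> bounded_borel"
  shows "signed_integral \<mu> (\<lambda>x. \<Sum>i\<in>I. g i x) = (\<Sum>i\<in>I. signed_integral \<mu> (g i))"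
  using assms
  by (simp add: signed_integral_def integrable_positive_part signed_measure_uminus sum_subtractf)

text \<open>Dominated convergence for each of the two Jordan parts; constants are integrable
  dominating functions because both parts are finite.\<close>

lemma signed_integral_tendsto:
  assumes "\<mu> \<in> signed_measures" and "\<And>n. U n \<in> borel_measurable borel"
    and "\<And>n x. \<bar>U n x\<bar> \<le> K" and "\<And>x. (\<lambda>n. U n x) \<longlonglongrightarrow> g x"
  shows "(\<lambda>n. signed_integral \<mu> (U n)) \<longlonglongrightarrow> signed_integral \<mu> g"
proof -
  have meas: "g \<in> borel_measurable borel"
    by (rule borel_measurable_LIMSEQ_real[OF assms(4,2)])
  have tendsto: "(\<lambda>n. integral\<^sup>L (positive_part \<nu>) (U n)) \<longlonglongrightarrow> integral\<^sup>L (positive_part \<nu>) g"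
    if \<nu>: "\<nu> \<in> signed_measures" for \<nu> :: "'a set \<Rightarrow> real"
  proof (rule integral_dominated_convergence)
    show "integrable (positive_part \<nu>) (\<lambda>_. K)"
      by (intro integrable_positive_part[OF \<nu>] bounded_borelI[where K="\<bar>K\<bar>"]) auto
  qed (use assms(2-) meas in simp_all)
  show ?thesis
    unfolding signed_integral_def
    by (intro tendsto_diff tendsto signed_measure_uminus assms(1))
qed

text \<open>Each Jordan part has total mass at most \<open>tv_norm \<mu>\<close>, and estimating the
  two separately costs the factor 2. Only some uniform bound is wanted later, so this is sharp
  enough.\<close>

lemma abs_signed_integral_le:
  assumes \<mu>: "\<mu> \<in> signed_measures" and g: "g \<in> borel_measurable borel" and K: "\<And>x. \<bar>g x\<bar> \<le> K"
  shows "\<bar>signed_integral \<mu> g\<bar> \<le> 2 * K * tv_norm \<mu>"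
proof -
  have K0: "0 \<le> K" using K[of undefined] by linarith
  have bound: "\<bar>integral\<^sup>L (positive_part \<nu>) g\<bar> \<le> K * tv_norm \<nu>"
    if \<nu>: "\<nu> \<in> signed_measures" for \<nu>
  proof -
    interpret finite_measure "positive_part \<nu>"
      by (rule finite_measure_positive_part) fact
    have "\<bar>integral\<^sup>L (positive_part \<nu>) g\<bar> \<le> integral\<^sup>L (positive_part \<nu>) (\<lambda>x. \<bar>g x\<bar>)"
      by (rule integral_abs_bound)
    also have "\<dots> \<le> integral\<^sup>L (positive_part \<nu>) (\<lambda>x. K)"
      using K g by (intro integral_mono integrable_positive_part[OF \<nu>] integrable_abs)
        (use K0 in \<open>auto intro!: bounded_borelI[where K=K]\<close>)
    also have "\<dots> = K * measure (positive_part \<nu>) UNIV"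
      by simp
    also have "\<dots> \<le> K * tv_norm \<nu>"
      by (intro mult_left_mono measure_positive_part_le_tv_norm \<nu> K0)
    finally show ?thesis .
  qed
  show ?thesis
    unfolding signed_integral_def
    using bound[OF \<mu>] bound[OF signed_measure_uminus[OF \<mu>]] by (simp add: tv_norm_uminus)
qed

text \<open>Jordan parts do not depend linearly on the measure, so the definition gives no direct
  proof. On indicators both sides are values of the set functions; the identity then spreads to all
  bounded Borel \<open>g\<close>.\<close>

lemma signed_integral_lincomb_measure:
  assumes "\<mu> \<in> signed_measures" and "\<nu> \<in> signed_measures" and "g \<in> bounded_borel"
  shows "signed_integral (\<lambda>A. a * \<mu> A + b * \<nu> A) g =
    a * signed_integral \<mu> g + b * signed_integral \<nu> g"
  using assms(3)
proof (induction rule: bounded_borel_induct)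
  case (indicator A)
  then show ?case
    using assms by (simp add: signed_integral_indicator signed_measure_lincomb)
next
  case (scale c g)
  then show ?case by (simp add: signed_integral_scale algebra_simps)
next
  case (add g h)
  then show ?case
    using assms by (simp add: signed_integral_add signed_measure_lincomb algebra_simps)
next
  case (lim U K g)
  note tendsto = signed_integral_tendsto[OF _ lim.hyps]
  have "(\<lambda>n. signed_integral (\<lambda>A. a * \<mu> A + b * \<nu> A) (U n)) \<longlonglongrightarrow>
      a * signed_integral \<mu> g + b * signed_integral \<nu> g"
    unfolding lim.IH by (intro tendsto_intros tendsto assms)
  then show ?case
    using tendsto[OF signed_measure_lincomb[OF assms(1,2)]] LIMSEQ_unique by blast
qed

section \<open>Point masses\<close>

definition dirac :: "'a::topological_space \<Rightarrow> 'a set \<Rightarrow> real" where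
  "dirac x = (\<lambda>A. if A \<in> sets borel then indicat_real A x else 0)"

lemma dirac_signed_measure: "dirac x \<in> signed_measures"
proof (rule signed_measuresI)
  fix A :: "nat \<Rightarrow> 'a set"
  assume A: "range A \<subseteq> sets borel" "disjoint_family A"
  have "(\<lambda>i. indicat_real (A i) x) sums indicat_real (\<Union>i. A i) x"
    by (rule indicator_sums) (use A in \<open>auto simp: disjoint_family_on_def\<close>)
  then show "(\<lambda>i. dirac x (A i)) sums dirac x (\<Union>i. A i)"
    using A by (auto simp: dirac_def range_subsetD)
qed (auto simp: dirac_def indicator_def)

lemma signed_integral_dirac: "g \<in> bounded_borel \<Longrightarrow> signed_integral (dirac x) g = g x"
proof (induction rule: bounded_borel_induct)
  case (indicator A)
  then show ?case by (simp add: signed_integral_indicator dirac_signed_measure) (simp add: dirac_def)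
next
  case (scale c g)
  then show ?case by (simp add: signed_integral_scale)
next
  case (add g h)
  then show ?case by (simp add: signed_integral_add dirac_signed_measure)
next
  case (lim U K g)
  have "(\<lambda>n. U n x) \<longlonglongrightarrow> signed_integral (dirac x) g"
    using signed_integral_tendsto[OF dirac_signed_measure lim.hyps, of x] by (simp add: lim.IH)
  then show ?case
    using lim.hyps(3) by (rule LIMSEQ_unique)
qed

section \<open>Kernel operators, their standard duals and Fubini for kernels\<close>

lemma kernel_signed_measure: "bounded_signed_kernel p \<Longrightarrow> p x \<in> signed_measures"
  by (simp add: bounded_signed_kernel_def)

lemma kernel_tv_norm_bounded:
  assumes "bounded_signed_kernel p"
  shows "\<exists>C. \<forall>x. tv_norm (p x) \<le> C"
  using assms unfolding bounded_signed_kernel_def bdd_above_def by auto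

lemma abs_kernel_le:
  assumes "bounded_signed_kernel p" and "\<forall>x. tv_norm (p x) \<le> C"
  shows "\<bar>p x A\<bar> \<le> C"
  using abs_signed_measure_le[OF kernel_signed_measure[OF assms(1)], of x A] assms(2)
  by (meson order_trans)

lemma kernel_measurable:
  assumes "bounded_signed_kernel p"
  shows "(\<lambda>x. p x A) \<in> borel_measurable borel"
proof (cases "A \<in> sets borel")
  case True
  then show ?thesis using assms by (simp add: bounded_signed_kernel_def)
next
  case False
  then show ?thesis
    by (simp add: signed_measure_outside[OF kernel_signed_measure[OF assms]])
qed

lemma kernel_bounded_borel:
  assumes "bounded_signed_kernel p"
  shows "(\<lambda>x. p x A) \<in> bounded_borel"
  using kernel_tv_norm_bounded[OF assms] abs_kernel_le[OF assms]
  by (auto intro: bounded_borelI kernel_measurable[OF assms])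

text \<open>Measurability starts from \<open>p x A\<close> on indicators and survives pointwise
  limits. Boundedness uses the bound on \<open>tv_norm (p x)\<close> that is uniform in
  \<open>x\<close>.\<close>

lemma kernel_op_bounded_borel:
  assumes p: "bounded_signed_kernel p" and g: "g \<in> bounded_borel"
  shows "kernel_op p g \<in> bounded_borel"
proof -
  note ps = kernel_signed_measure[OF p]
  obtain C where C: "\<forall>x. tv_norm (p x) \<le> C"
    using kernel_tv_norm_bounded[OF p] by blast
  have "(\<lambda>x. signed_integral (p x) g) \<in> borel_measurable borel"
    using g
  proof (induction rule: bounded_borel_induct)
    case (indicator A)
    then show ?case
      using ps kernel_measurable[OF p] by (simp add: signed_integral_indicator)
  next
    case (scale c g)
    then show ?case by (simp add: signed_integral_scale)
  next
    case (add g h)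
    then show ?case using ps by (simp add: signed_integral_add)
  next
    case (lim U K g)
    then show ?case
      by (intro borel_measurable_LIMSEQ_real[OF signed_integral_tendsto[OF ps lim.hyps]] lim.IH)
  qed
  moreover obtain K where K: "g \<in> borel_measurable borel" "0 \<le> K" "\<And>x. \<bar>g x\<bar> \<le> K"
    using g by (rule bounded_borelE) blast
  have "\<bar>signed_integral (p x) g\<bar> \<le> 2 * K * C" for x
    using abs_signed_integral_le[OF ps K(1,3), of x] mult_left_mono[OF C[rule_format], of "2 * K" x] K(2)
    by linarith
  ultimately show ?thesis
    unfolding kernel_op_def by (intro bounded_borelI)
qed

text \<open>Countable additivity of each \<open>p x\<close> is integrated against
  \<open>\<mu>\<close>, exchanging sum and integral by bounded convergence.\<close>

lemma kernel_dual_signed_measure: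
  assumes p: "bounded_signed_kernel p" and \<mu>: "\<mu> \<in> signed_measures"
  shows "kernel_dual p \<mu> \<in> signed_measures"
proof -
  note ps = kernel_signed_measure[OF p]
  obtain C where C: "\<forall>x. tv_norm (p x) \<le> C"
    using kernel_tv_norm_bounded[OF p] by blast
  show ?thesis
  proof (rule signed_measuresI)
    show "\<bar>kernel_dual p \<mu> A\<bar> \<le> 2 * C * tv_norm \<mu>" if "A \<in> sets borel" for A
      using abs_signed_integral_le[OF \<mu> kernel_measurable[OF p] abs_kernel_le[OF p C]] that by (simp add: kernel_dual_def)
  next
    fix A :: "nat \<Rightarrow> 'a set"
    assume A: "range A \<subseteq> sets borel" "disjoint_family A"
    \<comment> \<open>Writing a partial sum as the value of \<open>p x\<close> on one set bounds it
      by \<open>C\<close>, uniformly in \<open>n\<close> and \<open>x\<close>.\<close>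
    have partial: "(\<Sum>i<n. p x (A i)) = p x (\<Union>i<n. A i)" for x n
    proof (induction n)
      case 0
      then show ?case by (simp add: signed_measure_empty[OF ps])
    next
      case (Suc n)
      have "(\<Union>i<n. A i) \<inter> A n = {}"
        using A(2) by (rule disjoint_family_UN_lessThan)
      then have "p x ((\<Union>i<n. A i) \<union> A n) = p x (\<Union>i<n. A i) + p x (A n)"
        using A(1) by (intro signed_measure_Un[OF ps]) auto
      then show ?case using Suc by (simp add: lessThan_Suc Un_commute)
    qed
    have "(\<lambda>n. signed_integral \<mu> (\<lambda>x. \<Sum>i<n. p x (A i))) \<longlonglongrightarrow>
        signed_integral \<mu> (\<lambda>x. p x (\<Union>i. A i))"
    proof (rule signed_integral_tendsto[OF \<mu>, where K=C])
      show "\<bar>\<Sum>i<n. p x (A i)\<bar> \<le> C" for n x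
        unfolding partial by (rule abs_kernel_le[OF p C])
      show "(\<lambda>n. \<Sum>i<n. p x (A i)) \<longlonglongrightarrow> p x (\<Union>i. A i)" for x
        using signed_measure_sums[OF ps A] by (simp add: sums_def)
    qed (intro borel_measurable_sum kernel_measurable[OF p])
    then show "(\<lambda>i. kernel_dual p \<mu> (A i)) sums kernel_dual p \<mu> (\<Union>i. A i)"
      using A(1) unfolding sums_def
      by (simp add: kernel_dual_def range_subsetD sets.countable_UN
          signed_integral_sum[OF \<mu> kernel_bounded_borel[OF p]])
  qed (simp add: kernel_dual_def)
qed

text \<open>On an indicator this is the definition of the dual. In the limit case bounded
  convergence is used twice: inside, for each \<open>p x\<close>, and outside, for
  \<open>\<mu>\<close>.\<close>

lemma signed_integral_kernel_dual:
  assumes p: "bounded_signed_kernel p" and \<mu>: "\<mu> \<in> signed_measures" and g: "g \<in> bounded_borel"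
  shows "signed_integral (kernel_dual p \<mu>) g = signed_integral \<mu> (kernel_op p g)"
  using g
proof (induction rule: bounded_borel_induct)
  note ps = kernel_signed_measure[OF p]
  note dual = kernel_dual_signed_measure[OF p \<mu>]
  note op = kernel_op_bounded_borel[OF p]
  {
    case (indicator A)
    then show ?case
      using dual ps by (simp add: signed_integral_indicator kernel_op_def) (simp add: kernel_dual_def)
  next
    case (scale c g)
    then show ?case by (simp add: signed_integral_scale kernel_op_def)
  next
    case (add g h)
    have "kernel_op p (\<lambda>x. g x + h x) = (\<lambda>x. kernel_op p g x + kernel_op p h x)"
      using add ps by (simp add: kernel_op_def signed_integral_add)
    then show ?case
      using add dual op \<mu> by (simp add: signed_integral_add)
  next
    case (lim U K g)
    obtain C where C: "\<forall>x. tv_norm (p x) \<le> C"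
      using kernel_tv_norm_bounded[OF p] by blast
    have K: "0 \<le> K" using lim(2)[of 0 undefined] by linarith
    have U: "U n \<in> bounded_borel" for n
      using lim.hyps(1,2) by (rule bounded_borelI)
    have "(\<lambda>n. signed_integral \<mu> (kernel_op p (U n))) \<longlonglongrightarrow> signed_integral \<mu> (kernel_op p g)"
    \<comment> \<open>\<open>K\<close> bounds the \<open>U n\<close> and \<open>C\<close> the
      variations of the \<open>p x\<close>; the 2 comes from
      \<open>abs_signed_integral_le\<close>.\<close>
    proof (rule signed_integral_tendsto[OF \<mu>, where K="2 * K * C"])
      show "kernel_op p (U n) \<in> borel_measurable borel" for n
        using op[OF U] by (rule bounded_borel_measurable)
      show "\<bar>kernel_op p (U n) x\<bar> \<le> 2 * K * C" for n x
        unfolding kernel_op_def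
        using abs_signed_integral_le[OF ps lim.hyps(1,2), of x]
          mult_left_mono[OF C[rule_format], of "2 * K" x] K
        by (meson mult_nonneg_nonneg order_trans zero_le_numeral)
      show "(\<lambda>n. kernel_op p (U n) x) \<longlonglongrightarrow> kernel_op p g x" for x
        unfolding kernel_op_def by (rule signed_integral_tendsto[OF ps lim.hyps])
    qed
    moreover have "(\<lambda>n. signed_integral \<mu> (kernel_op p (U n))) \<longlonglongrightarrow> signed_integral (kernel_dual p \<mu>) g"
      using signed_integral_tendsto[OF dual lim.hyps] by (simp only: lim.IH)
    ultimately show ?case
      by (rule LIMSEQ_unique[rotated])
  }
qed

lemma kernel_dual_dirac:
  assumes "bounded_signed_kernel p"
  shows "kernel_dual p (dirac x) = p x"
  using signed_integral_dirac[OF kernel_bounded_borel[OF assms]]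
    signed_measure_outside[OF kernel_signed_measure[OF assms]]
  by (auto simp: kernel_dual_def)

lemma kernel_dual_lincomb:
  assumes "bounded_signed_kernel p" and "\<mu> \<in> signed_measures" and "\<nu> \<in> signed_measures"
  shows "kernel_dual p (\<lambda>A. a * \<mu> A + b * \<nu> A) =
    (\<lambda>A. a * kernel_dual p \<mu> A + b * kernel_dual p \<nu> A)"
  using signed_integral_lincomb_measure[OF assms(2,3) kernel_bounded_borel[OF assms(1)]]
  by (auto simp: kernel_dual_def)

section \<open>Existence of an \<open>f\<close>-dual operator and its form on generated
  functions\<close>

theorem proposition1p1:
  fixes f :: "'a::topological_space \<Rightarrow> 'b::topological_space \<Rightarrow> real"
    and p :: "'a \<Rightarrow> 'a set \<Rightarrow> real"
  assumes "case_prod f \<in> borel_measurable (borel \<Otimes>\<^sub>M borel)"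
    and "bounded (range (case_prod f))"
    and "separates_measures f"
    and "bounded_signed_kernel p"
  shows "(\<exists>S. f_dual_on (generated f) f (kernel_op p) S \<and> acts_under_integral f S) \<and>
    (\<forall>V S. generated f \<subseteq> V \<and> f_dual_on V f (kernel_op p) S \<and> acts_under_integral f S \<longrightarrow>
       (\<forall>g\<in>generated f.
          S g \<in> generated f \<and>
          S g = (F_op f \<circ> kernel_dual p \<circ> F_inv f) g \<and>
          (F_inv f \<circ> S) g = (kernel_dual p \<circ> F_inv f) g))"
proof -
  note meas = assms(1) and p = assms(4)
  obtain K where K: "\<And>x y. \<bar>f x y\<bar> \<le> K"
    using assms(2) unfolding bounded_iff by auto
  have f_section: "(\<lambda>x. f x y) \<in> bounded_borel" for y
    using measurable_compose[OF measurable_Pair2' meas, of y] K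
    by (intro bounded_borelI[where K=K]) auto
  have F_bounded: "F_op f Q \<in> bounded_borel" if Q: "Q \<in> signed_measures" for Q
  proof (rule bounded_borelI)
    \<comment> \<open>Measurability in the parameter \<open>y\<close> comes from Fubini for the
      finite measure \<open>positive_part \<nu>\<close>; joint measurability of \<open>f\<close>
      enters here with its arguments swapped, the parameter coming first.\<close>
    have int: "(\<lambda>y. integral\<^sup>L (positive_part \<nu>) (\<lambda>x. f x y)) \<in> borel_measurable borel"
      if \<nu>: "\<nu> \<in> signed_measures" for \<nu>
    proof -
      interpret finite_measure "positive_part \<nu>"
        by (rule finite_measure_positive_part) fact
      have "(\<lambda>(y, x). f x y) \<in> borel_measurable (borel \<Otimes>\<^sub>M positive_part \<nu>)"
        using measurable_compose[OF measurable_pair_swap' meas]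
        by (simp add: case_prod_beta' cong: measurable_cong_sets)
      then show ?thesis by (rule borel_measurable_lebesgue_integral)
    qed
    show "F_op f Q \<in> borel_measurable borel"
      unfolding F_op_def signed_integral_def
      using int[OF Q] int[OF signed_measure_uminus[OF Q]] by simp
    show "\<bar>F_op f Q y\<bar> \<le> 2 * K * tv_norm Q" for y
      unfolding F_op_def using bounded_borel_measurable[OF f_section] K
      by (intro abs_signed_integral_le[OF Q])
  qed
  have F_inv_F: "F_inv f (F_op f Q) = Q" if "Q \<in> signed_measures" for Q
    unfolding F_inv_def using inj_on_F_op[OF assms(3)] that by (rule the_inv_into_f_f)
  have F_lincomb: "F_op f (\<lambda>A. a * Q A + b * R A) = (\<lambda>y. a * F_op f Q y + b * F_op f R y)"
    if "Q \<in> signed_measures" "R \<in> signed_measures" for Q R a b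
    unfolding F_op_def using signed_integral_lincomb_measure[OF that f_section] by simp
  have f_dirac: "f x = F_op f (dirac x)" for x
    unfolding F_op_def using signed_integral_dirac[OF f_section] by simp
  note dual = kernel_dual_signed_measure[OF p]
  have F_dual: "F_op f (kernel_dual p Q) y = signed_integral Q (kernel_op p (\<lambda>x. f x y))"
    if "Q \<in> signed_measures" for Q y
    unfolding F_op_def by (rule signed_integral_kernel_dual[OF p that f_section])

  \<comment> \<open>This witness is total as a function, but its values are controlled only on
    generated functions, where \<open>F_inv f\<close> really inverts \<open>F_op f\<close>.\<close>
  define S where "S = F_op f \<circ> kernel_dual p \<circ> F_inv f"
  have S_F: "S (F_op f Q) = F_op f (kernel_dual p Q)" if "Q \<in> signed_measures" for Q
    unfolding S_def using that by (simp add: F_inv_F)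
  have S_f: "S (f x) y = kernel_op p (\<lambda>x'. f x' y) x" for x y
    by (simp only: f_dirac[of x] S_F[OF dirac_signed_measure] kernel_dual_dirac[OF p])
      (simp add: F_op_def kernel_op_def)
  have "linear_operator_on (generated f) S"
    unfolding linear_operator_on_def
  proof (intro conjI ballI allI)
    show "generated f \<subseteq> bounded_borel" "S ` generated f \<subseteq> bounded_borel"
      using F_bounded dual by (auto simp: generated_def S_F)
    fix g h a b assume "g \<in> generated f" "h \<in> generated f"
    then obtain Q R where Q: "Q \<in> signed_measures" "g = F_op f Q"
      and R: "R \<in> signed_measures" "h = F_op f R"
      by (auto simp: generated_def)
    \<comment> \<open>Linearity is checked on the generating measures: \<open>?M\<close> generates
      the combination of \<open>g\<close> and \<open>h\<close>, and both
      \<open>kernel_dual p\<close> and \<open>F_op f\<close> respect linear combinations.\<close>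
    let ?M = "\<lambda>A. a * Q A + b * R A"
    have M: "?M \<in> signed_measures" using Q R by (intro signed_measure_lincomb)
    have eq: "(\<lambda>y. a * g y + b * h y) = F_op f ?M"
      using Q R F_lincomb by simp
    then show "(\<lambda>y. a * g y + b * h y) \<in> generated f"
      using M by (auto simp: generated_def)
    show "S (\<lambda>y. a * g y + b * h y) = (\<lambda>y. a * S g y + b * S h y)"
      unfolding eq S_F[OF M] using Q R
      by (simp add: S_F kernel_dual_lincomb[OF p] F_lincomb dual)
  qed
  moreover have "f x \<in> generated f" for x
    unfolding f_dirac[of x] generated_def using dirac_signed_measure by blast
  ultimately have "f_dual_on (generated f) f (kernel_op p) S"
    unfolding f_dual_on_def using S_f by blast
  \<comment> \<open>Both sides at \<open>Q\<close> and \<open>y\<close> equal the integral of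
    \<open>kernel_op p (\<lambda>x. f x y)\<close> against \<open>Q\<close>: the left by Fubini for
    the kernel, the right by duality.\<close>
  moreover have "acts_under_integral f S"
    unfolding acts_under_integral_def by (simp add: S_F F_dual S_f)
  moreover have "S' g \<in> generated f \<and> S' g = (F_op f \<circ> kernel_dual p \<circ> F_inv f) g \<and>
      (F_inv f \<circ> S') g = (kernel_dual p \<circ> F_inv f) g"
    if "f_dual_on V f (kernel_op p) S'" "acts_under_integral f S'" "g \<in> generated f" for V S' g
  proof -
    obtain Q where Q: "Q \<in> signed_measures" "g = F_op f Q"
      using \<open>g \<in> generated f\<close> by (auto simp: generated_def)
    \<comment> \<open>\<open>S'\<close> moves under the integral over \<open>Q\<close>, duality
      turns its value on \<open>f x\<close> into \<open>kernel_op p\<close> on the first argument,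
      and \<open>F_dual\<close> recognizes the result.\<close>
    have "S' g y = F_op f (kernel_dual p Q) y" for y
      using that Q by (simp add: acts_under_integral_def f_dual_on_def F_dual)
    then have "S' g = F_op f (kernel_dual p Q)" by blast
    then show ?thesis
      using Q dual by (simp add: F_inv_F generated_def)
  qed
  ultimately show ?thesis by blast
qed

end
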